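(* Let $G$ be a group of $k \times k$ real orthogonal matrices and let $f \in \mathbb{R}^k$ be a vector such that $\mathcal{F} = Gf = \{Uf : U \in G\}$ is an irreducible rational group frame in $\mathbb{R}^k$. Then the lattice $L(\mathcal{F}) = \operatorname{span}_{\mathbb{Z}} \mathcal{F}$ is strongly eutactic.
   Context: Group frames: let $G$ be a finite group of orthogonal $k\times k$ real matrices and $f \in \mathbb{R}^k$. If the orbit $Gf = \{Uf : U\in G\}$ spans $\mathbb{R}^k$ over $\mathbb{R}$, it is called a group frame (or $G$-frame). $G$ acts irreducibly on $\mathbb{R}^k$ if no subspace $E$ with $\{0\} \ne E \subsetneq \mathbb{R}^k$ satisfies $GE = E$; a $G$-frame is called irreducible if $G$ acts irreducibly on $\mathbb{R}^k$. A frame $\mathcal{F} = \{f_1,\dots,f_n\}$ is rational if the inner products $\langle f_i,f_j\rangle$, $1\le i,j\le n$, are rational numbers up to one common nonzero real constant multiple; it is known that the integer span $L(\mathcal{F})$ of a rational frame in $\mathbb{R}^k$ is a lattice (a discrete co-compact subgroup of $\mathbb{R}^k$). For a lattice $L \subset \mathbb{R}^k$, let $|L| = \min\{\|x\| : x \in L\setminus\{0\}\}$ and let $S(L) = \{x \in L : \|x\| = |L|\}$ be the set of minimal vectors. $L$ is called strongly eutactic if there is a real constant $c > 0$ such that $\|v\|^2 = c\sum_{x \in S(L)} \langle v, x\rangle^2$ for all $v \in \mathbb{R}^k$. *)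

theory Defs
  imports "HOL-Analysis.Analysis" "HOL-Algebra.Group"
begin

subsection \<open>Group frames\<close>

definition orthogonal_group :: "(real^'n^'n) monoid" where
  "orthogonal_group = \<lparr>carrier = {U. orthogonal_matrix U}, mult = (**), one = mat 1\<rparr>"

lemma group_orthogonal_group: "group orthogonal_group"
proof (rule groupI)
  fix U :: "real^'n^'n"
  assume "U \<in> carrier orthogonal_group"
  then have "transpose U \<in> carrier orthogonal_group \<and>
      transpose U \<otimes>\<^bsub>orthogonal_group\<^esub> U = \<one>\<^bsub>orthogonal_group\<^esub>"
    by (simp add: orthogonal_group_def) (simp add: orthogonal_matrix_def)
  then show "\<exists>V\<in>carrier orthogonal_group. V \<otimes>\<^bsub>orthogonal_group\<^esub> U = \<one>\<^bsub>orthogonal_group\<^esub>"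
    by blast
qed (auto simp: orthogonal_group_def orthogonal_matrix_mul orthogonal_matrix_id matrix_mul_assoc)

lemma inv_orthogonal_group:
  assumes "orthogonal_matrix (U :: real^'n^'n)"
  shows "inv\<^bsub>orthogonal_group\<^esub> U = transpose U"
  by (rule group.inv_equality[OF group_orthogonal_group])
     (use assms in \<open>simp_all add: orthogonal_group_def\<close>,
      use assms in \<open>simp add: orthogonal_matrix_def\<close>)

definition group_orbit :: "(real^'n^'n) set \<Rightarrow> real^'n \<Rightarrow> (real^'n) set" where
  "group_orbit G f = {U *v f | U. U \<in> G}"

definition group_frame :: "(real^'n^'n) set \<Rightarrow> real^'n \<Rightarrow> bool" where
  "group_frame G f \<longleftrightarrow>
     finite G \<and> subgroup G orthogonal_group \<and> span (group_orbit G f) = UNIV"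

definition acts_irreducibly :: "(real^'n^'n) set \<Rightarrow> bool" where
  "acts_irreducibly G \<longleftrightarrow>
     \<not> (\<exists>E. subspace E \<and> {0} \<noteq> E \<and> E \<subset> UNIV \<and> {U *v x | U x. U \<in> G \<and> x \<in> E} = E)"

definition irreducible_group_frame :: "(real^'n^'n) set \<Rightarrow> real^'n \<Rightarrow> bool" where
  "irreducible_group_frame G f \<longleftrightarrow> group_frame G f \<and> acts_irreducibly G"

definition rational_frame :: "(real^'n) set \<Rightarrow> bool" where
  "rational_frame F \<longleftrightarrow> finite F \<and> span F = UNIV \<and>
     (\<exists>\<alpha>::real. \<alpha> \<noteq> 0 \<and> (\<forall>x\<in>F. \<forall>y\<in>F. \<alpha> * (x \<bullet> y) \<in> \<rat>))"


subsection \<open>Lattices\<close>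

definition int_span :: "'a::real_vector set \<Rightarrow> 'a set" where
  "int_span F = module.span (\<lambda>n::int. (*\<^sub>R) (of_int n)) F"

lemma module_int: "module (\<lambda>n::int. ((*\<^sub>R) (of_int n) :: 'a::real_vector \<Rightarrow> 'a))"
  by unfold_locales (simp_all add: algebra_simps)

lemma int_span_explicit:
  "int_span F = {(\<Sum>x\<in>t. of_int (c x) *\<^sub>R x) | t (c :: 'a::real_vector \<Rightarrow> int). finite t \<and> t \<subseteq> F}"
  unfolding int_span_def module.span_explicit[OF module_int] by simp

definition coset_topology :: "'a::real_normed_vector set \<Rightarrow> 'a set topology" where
  "coset_topology L = topology (\<lambda>V. V \<subseteq> UNIV // {(x, y). x - y \<in> L} \<and> open (\<Union>V))"

text \<open>The union of a set of cosets is its preimage under the projection onto the quotient, so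
  for an additive subgroup this is the quotient topology.\<close>

lemma openin_coset_topology:
  assumes "0 \<in> L" "\<And>x y. x \<in> L \<Longrightarrow> y \<in> L \<Longrightarrow> x - y \<in> L"
  shows "openin (coset_topology L) V \<longleftrightarrow>
           V \<subseteq> UNIV // {(x, y). x - y \<in> L} \<and> open (\<Union>V)"
proof -
  let ?r = "{(x, y). x - y \<in> L}"
  have neg: "- x \<in> L" if "x \<in> L" for x
    using assms(2)[OF assms(1) that] by simp
  have "equiv UNIV ?r"
  proof (rule equivI)
    show "sym ?r" using neg by (fastforce simp: sym_def)
    show "trans ?r"
    proof (rule transI, clarify)
      fix x y z assume "x - y \<in> L" "y - z \<in> L"
      from assms(2)[OF this(1) neg[OF this(2)]] show "x - z \<in> L" by simp
    qed
  qed (use assms(1) in \<open>auto simp: refl_on_def\<close>)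
  then have disj: "A = B \<or> A \<inter> B = {}" if "A \<in> UNIV // ?r" "B \<in> UNIV // ?r" for A B
    using quotient_disj that by metis
  have Int: "\<Union>(V \<inter> W) = \<Union>V \<inter> \<Union>W" if "V \<subseteq> UNIV // ?r" "W \<subseteq> UNIV // ?r" for V W
  proof
    show "\<Union>V \<inter> \<Union>W \<subseteq> \<Union>(V \<inter> W)"
    proof
      fix x assume "x \<in> \<Union>V \<inter> \<Union>W"
      then obtain A B where "A \<in> V" "B \<in> W" "x \<in> A" "x \<in> B" by blast
      moreover from this have "A = B" using disj[of A B] that by blast
      ultimately show "x \<in> \<Union>(V \<inter> W)" by blast
    qed
  qed blast
  have "\<Union>(\<Union>K) = (\<Union>V\<in>K. \<Union>V)" for K :: "'a set set set" by blast
  then have "istopology (\<lambda>V. V \<subseteq> UNIV // ?r \<and> open (\<Union>V))"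
    unfolding istopology_def by (auto simp: Int open_Int intro!: open_UN)
  then show ?thesis
    by (simp add: coset_topology_def topology_inverse')
qed

definition euclidean_lattice :: "'a::euclidean_space set \<Rightarrow> bool" where
  "euclidean_lattice L \<longleftrightarrow>
     0 \<in> L \<and> (\<forall>x\<in>L. \<forall>y\<in>L. x - y \<in> L) \<and>
     discrete L \<and> compact_space (coset_topology L)"

definition min_norm :: "'a::euclidean_space set \<Rightarrow> real" where
  "min_norm L = (LEAST r. \<exists>x\<in>L - {0}. r = norm x)"

definition min_vectors :: "'a::euclidean_space set \<Rightarrow> 'a set" where
  "min_vectors L = {x \<in> L. norm x = min_norm L}"

text \<open>A lattice has only finitely many minimal vectors, so the sum below is a genuine finite
  sum.\<close>

definition strongly_eutactic :: "'a::euclidean_space set \<Rightarrow> bool" where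
  "strongly_eutactic L \<longleftrightarrow> euclidean_lattice L \<and>
     (\<exists>c::real. c > 0 \<and> (\<forall>v. (norm v)\<^sup>2 = c * (\<Sum>x\<in>min_vectors L. (v \<bullet> x)\<^sup>2)))"

end

theory Submission
  imports Defs
begin

text \<open>Clearing denominators, some nonzero multiple of the inner product is integral on the
  \<open>\<int>\<close>-span \<open>L\<close> of the orbit, so that \<open>L\<close> is uniformly discrete; \<open>L\<close> is co-compact because
  rounding down the coordinates with respect to the orbit moves any vector into a fixed ball. Let
  \<open>Q v = (\<Sum>x\<in>min_vectors L. (v \<bullet> x)\<^sup>2)\<close> and let \<open>\<lambda>\<close> be its maximum on the unit sphere. The set of
  \<open>v\<close> with \<open>Q v = \<lambda> * (norm v)\<^sup>2\<close> is the null set of a positive semidefinite form, hence a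
  nonzero subspace, and it is invariant under \<open>G\<close>, which permutes the minimal vectors.
  Irreducibility makes it the whole space.\<close>

section \<open>Integer spans\<close>

lemma int_span_base: "x \<in> F \<Longrightarrow> x \<in> int_span F"
  unfolding int_span_def by (rule module.span_base[OF module_int])

lemma int_span_zero: "0 \<in> int_span F"
  unfolding int_span_def by (rule module.span_zero[OF module_int])

lemma int_span_diff: "x \<in> int_span F \<Longrightarrow> y \<in> int_span F \<Longrightarrow> x - y \<in> int_span F"
  unfolding int_span_def by (rule module.span_diff[OF module_int])

lemma int_span_add: "x \<in> int_span F \<Longrightarrow> y \<in> int_span F \<Longrightarrow> x + y \<in> int_span F"
  unfolding int_span_def by (rule module.span_add[OF module_int])

lemma int_span_scale: "x \<in> int_span F \<Longrightarrow> of_int n *\<^sub>R x \<in> int_span F"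
  unfolding int_span_def by (rule module.span_scale[OF module_int])

lemma int_span_sum: "(\<And>i. i \<in> I \<Longrightarrow> g i \<in> int_span F) \<Longrightarrow> sum g I \<in> int_span F"
  unfolding int_span_def by (rule module.span_sum[OF module_int])

text \<open>The vectors satisfying \<open>P\<close> form a submodule over the integers that contains
  \<open>F\<close>, and the span is the smallest such submodule.\<close>

lemma int_span_induct [consumes 1, case_names base zero add scale]:
  assumes "x \<in> int_span F"
    and "\<And>x. x \<in> F \<Longrightarrow> P x" and "P 0" and "\<And>x y. P x \<Longrightarrow> P y \<Longrightarrow> P (x + y)"
    and "\<And>(n::int) x. P x \<Longrightarrow> P (of_int n *\<^sub>R x)"
  shows "P x"
proof -
  have "int_span F \<subseteq> Collect P"
    unfolding int_span_def
    by (rule module.span_minimal[OF module_int])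
      (use assms(2-) in \<open>auto simp: module.subspace_def[OF module_int]\<close>)
  then show ?thesis
    using assms(1) by blast
qed

lemma int_span_linear_image:
  assumes "x \<in> int_span F" "linear h" "h ` F \<subseteq> int_span H"
  shows "h x \<in> int_span H"
  using assms(1)
proof (induction rule: int_span_induct)
  case base
  then show ?case using assms(3) by blast
qed (use assms(2) in
      \<open>simp_all add: linear_0 linear_add linear_scale int_span_zero int_span_add int_span_scale\<close>)

section \<open>Lattices\<close>

lemma Rats_finite_common_denominator:
  assumes "finite A" "A \<subseteq> (\<rat> :: real set)"
  obtains d :: int where "d > 0" "\<And>a. a \<in> A \<Longrightarrow> of_int d * a \<in> \<int>"
proof -
  have "\<exists>d::int. d > 0 \<and> (\<forall>a\<in>A. of_int d * a \<in> \<int>)"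
    using assms
  proof (induction rule: finite_induct)
    case empty
    show ?case by (intro exI[of _ 1]) simp
  next
    case (insert a A)
    then obtain d :: int where d: "d > 0" "\<And>b. b \<in> A \<Longrightarrow> of_int d * b \<in> \<int>"
      by auto
    have "a \<in> \<rat>" using insert.prems by simp
    then obtain p q :: int where q: "q > 0" "a = of_int p / of_int q"
      by (auto elim: Rats_cases')
    have "of_int (q * d) * a = of_int (d * p)" using q by simp
    then have "of_int (q * d) * a \<in> \<int>" by (metis Ints_of_int)
    moreover have "of_int (q * d) * b \<in> \<int>" if "b \<in> A" for b
      using Ints_mult[OF Ints_of_int[of q] d(2)[OF that]] by (simp add: mult.assoc)
    ultimately show ?case
      using q(1) d(1) by (intro exI[of _ "q * d"]) auto
  qed
  then show ?thesis using that by blast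
qed

text \<open>After scaling, a lattice vector has integral inner products with the frame. If it is
  short, Cauchy-Schwarz puts these integers below 1 in absolute value, so they vanish, and a vector
  orthogonal to a spanning set is 0.\<close>

lemma rational_frame_separated:
  assumes "rational_frame F"
  obtains e where "e > 0" "\<And>x. x \<in> int_span F \<Longrightarrow> x \<noteq> 0 \<Longrightarrow> e \<le> norm x"
proof -
  obtain \<alpha> where F: "finite F" "span F = UNIV" and "\<alpha> \<noteq> 0"
    and rat: "\<And>x y. x \<in> F \<Longrightarrow> y \<in> F \<Longrightarrow> \<alpha> * (x \<bullet> y) \<in> \<rat>"
    using assms unfolding rational_frame_def by blast
  obtain d :: int where "d > 0"
    and d: "\<And>a. a \<in> (\<lambda>(x, y). \<alpha> * (x \<bullet> y)) ` (F \<times> F) \<Longrightarrow> of_int d * a \<in> \<int>"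
    by (rule Rats_finite_common_denominator[of "(\<lambda>(x, y). \<alpha> * (x \<bullet> y)) ` (F \<times> F)"])
      (use F rat in auto)
  define \<beta> where "\<beta> = of_int d * \<alpha>"
  have "\<beta> \<noteq> 0" using \<open>d > 0\<close> \<open>\<alpha> \<noteq> 0\<close> by (simp add: \<beta>_def)
  have int: "\<beta> * (x \<bullet> y) \<in> \<int>" if "x \<in> int_span F" "y \<in> F" for x y
    using that(1)
  proof (induction rule: int_span_induct)
    case (base x)
    then show ?case using d[of "\<alpha> * (x \<bullet> y)"] that(2) by (force simp: \<beta>_def mult.assoc)
  next
    case (scale n x)
    have "of_int n * (\<beta> * (x \<bullet> y)) \<in> \<int>" using scale by (rule Ints_mult[OF Ints_of_int])
    then show ?case by (simp add: mult.left_commute)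
  qed (simp_all add: inner_add_left distrib_left)
  \<comment> \<open>A common bound for the norms of the frame vectors; the summand 1 makes it
    positive at once.\<close>
  define m where "m = 1 + (\<Sum>y\<in>F. norm y)"
  have "m > 0" unfolding m_def by (intro add_pos_nonneg sum_nonneg) auto
  show ?thesis
  proof (rule that[of "1 / (\<bar>\<beta>\<bar> * m)"])
    show "0 < 1 / (\<bar>\<beta>\<bar> * m)" using \<open>\<beta> \<noteq> 0\<close> \<open>m > 0\<close> by simp
    fix x assume x: "x \<in> int_span F" "x \<noteq> 0"
    show "1 / (\<bar>\<beta>\<bar> * m) \<le> norm x"
    proof (rule ccontr)
      assume "\<not> ?thesis"
      then have small: "\<bar>\<beta>\<bar> * (norm x * m) < 1"
        using \<open>\<beta> \<noteq> 0\<close> \<open>m > 0\<close> by (simp add: field_simps)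
      have "x \<bullet> y = 0" if "y \<in> F" for y
      proof -
        have "norm y \<le> m"
          unfolding m_def using member_le_sum[of y F norm] F that by fastforce
        then have "\<bar>x \<bullet> y\<bar> \<le> norm x * m"
          by (meson Cauchy_Schwarz_ineq2 mult_left_mono norm_ge_zero order_trans)
        then have "\<bar>\<beta> * (x \<bullet> y)\<bar> < 1"
          using small mult_left_mono[of "\<bar>x \<bullet> y\<bar>" "norm x * m" "\<bar>\<beta>\<bar>"] by (simp add: abs_mult)
        then have "\<beta> * (x \<bullet> y) = 0"
          using int[OF x(1) that] Ints_nonzero_abs_less1 by blast
        then show ?thesis using \<open>\<beta> \<noteq> 0\<close> by simp
      qed
      then have "orthogonal x x"
        by (intro orthogonal_to_span[of x F]) (auto simp: F orthogonal_def)
      then show False using x(2) by (simp add: orthogonal_def)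
    qed
  qed
qed

lemma uniform_discrete_int_span:
  assumes "rational_frame F"
  shows "uniform_discrete (int_span F)"
proof -
  obtain e where "e > 0" and e: "\<And>x. x \<in> int_span F \<Longrightarrow> x \<noteq> 0 \<Longrightarrow> e \<le> norm x"
    using rational_frame_separated[OF assms] by blast
  have "x = y" if "x \<in> int_span F" "y \<in> int_span F" "dist x y < e" for x y
    using e[OF int_span_diff[OF that(1,2)]] that(3) by (force simp: dist_norm)
  with \<open>e > 0\<close> show ?thesis
    unfolding uniform_discrete_def by blast
qed

text \<open>Uniform discreteness makes \<open>L\<close> closed, which mere discreteness would not;
  the intersection with a ball is then both compact and discrete.\<close>

lemma uniform_discrete_finite_cball:
  fixes L :: "'a::heine_borel set"
  assumes "uniform_discrete L"
  shows "finite (L \<inter> cball a r)"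
proof -
  have "compact (L \<inter> cball a r)"
    using uniform_discrete_imp_closed[OF assms] by (simp add: closed_Int_compact)
  moreover have "discrete (L \<inter> cball a r)"
    using uniform_discrete_imp_discrete[OF assms] by (rule discrete_subset) simp
  ultimately show ?thesis
    using discrete_compact_finite_iff by blast
qed

section \<open>Co-compactness\<close>

lemma compact_space_coset_topology:
  fixes L :: "'a::euclidean_space set"
  assumes L: "0 \<in> L" "\<And>x y. x \<in> L \<Longrightarrow> y \<in> L \<Longrightarrow> x - y \<in> L"
    and r: "\<And>v. \<exists>x\<in>L. norm (v - x) \<le> r"
  shows "compact_space (coset_topology L)"
proof -
  let ?r = "{(x, y). x - y \<in> L}"
  \<comment> \<open>The projection onto the quotient. It will be continuous, and a closed ball of
    radius \<open>r\<close> meets every coset, so the quotient is the image of a compact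
    set.\<close>
  define p where "p v = ?r `` {v}" for v
  have neg: "- x \<in> L" if "x \<in> L" for x
    using L(2)[OF L(1) that] by simp
  have p_eq: "p v = p w" if "v - w \<in> L" for v w
  proof -
    have "v - x \<in> L \<longleftrightarrow> w - x \<in> L" for x
      using L(2)[OF _ that, of "v - x"] L(2)[OF _ neg[OF that], of "w - x"] by auto
    then show ?thesis by (auto simp: p_def)
  qed
  have p_mem: "x \<in> p v \<longleftrightarrow> v - x \<in> L" for x v
    by (simp add: p_def)
  have preimage: "{v. p v \<in> V} = \<Union>V" if V: "V \<subseteq> UNIV // ?r" for V
  proof
    show "{v. p v \<in> V} \<subseteq> \<Union>V" using L(1) by (auto simp: p_mem)
    show "\<Union>V \<subseteq> {v. p v \<in> V}"
    proof clarify
      fix x A assume "A \<in> V" "x \<in> A"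
      moreover from this obtain v where "A = p v"
        using V by (auto simp: p_def quotient_def)
      ultimately show "p x \<in> V" using p_eq[of v x] by (simp add: p_mem)
    qed
  qed
  have open_iff: "openin (coset_topology L) V \<longleftrightarrow> V \<subseteq> UNIV // ?r \<and> open (\<Union>V)" for V
    by (rule openin_coset_topology[OF L])
  have "\<Union>(UNIV // ?r) = UNIV"
    using preimage[of "UNIV // ?r"] by (auto simp: p_def quotient_def)
  then have "openin (coset_topology L) (UNIV // ?r)"
    by (simp add: open_iff)
  then have top: "topspace (coset_topology L) = UNIV // ?r"
    unfolding topspace_def using open_iff by blast
  have "continuous_map euclidean (coset_topology L) p"
    unfolding continuous_map_def top
    using preimage by (auto simp: open_iff p_def quotient_def)
  then have "compactin (coset_topology L) (p ` cball 0 r)"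
    by (rule image_compactin[rotated]) simp
  moreover have "p ` cball 0 r = UNIV // ?r"
  proof
    show "UNIV // ?r \<subseteq> p ` cball 0 r"
    proof
      fix A assume "A \<in> UNIV // ?r"
      then obtain v where A: "A = p v" by (auto simp: p_def quotient_def)
      \<comment> \<open>Subtracting a nearby lattice vector gives a representative of the same coset
        inside the ball.\<close>
      obtain x where "x \<in> L" "norm (v - x) \<le> r" using r by blast
      then show "A \<in> p ` cball 0 r"
        using p_eq[of v "v - x"] A by auto
    qed
  qed (auto simp: p_def quotient_def)
  ultimately show ?thesis by (simp add: compact_space_def top)
qed

text \<open>Any coordinates of \<open>v\<close> will do, even if \<open>F\<close> is linearly
  dependent: rounding down leaves coefficients in [0,1), and the triangle inequality bounds the
  remainder.\<close>

lemma int_span_cobounded: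
  fixes F :: "'a::real_normed_vector set"
  assumes "finite F" "span F = UNIV"
  shows "\<exists>x\<in>int_span F. norm (v - x) \<le> (\<Sum>y\<in>F. norm y)"
proof -
  have "v \<in> span F" using assms(2) by simp
  then obtain u where v: "v = (\<Sum>y\<in>F. u y *\<^sub>R y)"
    using assms(1) by (auto simp: span_finite)
  define x where "x = (\<Sum>y\<in>F. of_int \<lfloor>u y\<rfloor> *\<^sub>R y)"
  have "v - x = (\<Sum>y\<in>F. frac (u y) *\<^sub>R y)"
    by (simp add: v x_def frac_def scaleR_diff_left sum_subtractf)
  also have "norm \<dots> \<le> (\<Sum>y\<in>F. norm y)"
    by (rule sum_norm_le)
      (simp add: mult_left_le_one_le frac_ge_0 less_imp_le[OF frac_lt_1])
  finally have "norm (v - x) \<le> (\<Sum>y\<in>F. norm y)" .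
  moreover have "x \<in> int_span F"
    unfolding x_def by (intro int_span_sum int_span_scale int_span_base)
  ultimately show ?thesis by blast
qed

lemma euclidean_lattice_int_span:
  assumes "rational_frame F"
  shows "euclidean_lattice (int_span F)"
proof -
  have "discrete (int_span F)"
    using assms by (intro uniform_discrete_imp_discrete uniform_discrete_int_span)
  moreover have "compact_space (coset_topology (int_span F))"
    using int_span_cobounded[of F] assms
    by (intro compact_space_coset_topology int_span_zero int_span_diff)
      (auto simp: rational_frame_def)
  ultimately show ?thesis
    by (simp add: euclidean_lattice_def int_span_zero int_span_diff)
qed

section \<open>Existence of minimal vectors\<close>

lemma min_norm_attained:
  assumes "\<And>r. finite (L \<inter> cball 0 r)" "y \<in> L" "y \<noteq> 0"
  obtains x where "x \<in> L" "x \<noteq> 0" "norm x = min_norm L"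
proof -
  \<comment> \<open>A \<open>LEAST\<close> over the reals is only meaningful if a minimum exists.
    Cutting off at \<open>norm y\<close> leaves finitely many candidate norms, and longer vectors
    cannot compete with \<open>y\<close>.\<close>
  define N where "N = norm ` ((L - {0}) \<inter> cball 0 (norm y))"
  have N: "finite N" "norm y \<in> N"
    unfolding N_def
    using assms(2,3) finite_subset[OF _ assms(1)[of "norm y"], of "(L - {0}) \<inter> cball 0 (norm y)"]
    by auto
  have "min_norm L = Min N"
    unfolding min_norm_def
  proof (rule Least_equality)
    show "\<exists>x\<in>L - {0}. Min N = norm x"
      using Min_in[of N] N unfolding N_def by blast
    fix s assume "\<exists>x\<in>L - {0}. s = norm x"
    then obtain x where x: "x \<in> L - {0}" "s = norm x" by blast
    show "Min N \<le> s"
    proof (cases "norm x \<le> norm y")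
      case True
      then have "s \<in> N" using x by (auto simp: N_def)
      then show ?thesis using N(1) by simp
    next
      case False
      then show ?thesis using Min_le[OF N] x(2) by simp
    qed
  qed
  moreover have "Min N \<in> N"
    using Min_in[of N] N by blast
  ultimately obtain x where "x \<in> L - {0}" "min_norm L = norm x"
    unfolding N_def by auto
  then show ?thesis by (intro that[of x]) auto
qed

section \<open>Irreducible actions\<close>

lemma orthogonal_group_transformation:
  assumes "subgroup G orthogonal_group" "U \<in> G"
  shows "orthogonal_transformation ((*v) U)"
  using subgroup.mem_carrier[OF assms]
  by (simp add: orthogonal_group_def orthogonal_transformation_matrix)

text \<open>If \<open>Q v\<close> and \<open>Q w\<close> vanish, the parallelogram law makes the two
  nonnegative values at \<open>v + w\<close> and \<open>v - w\<close> add up to 0, so both are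
  0.\<close>

lemma subspace_null_set:
  fixes Q :: "'a::real_inner \<Rightarrow> real"
  assumes "\<And>v. 0 \<le> Q v" "\<And>c v. Q (c *\<^sub>R v) = c\<^sup>2 * Q v"
    and "\<And>v w. Q (v + w) + Q (v - w) = 2 * Q v + 2 * Q w"
  shows "subspace {v. Q v = 0}"
  unfolding subspace_def
proof (intro conjI ballI allI)
  show "0 \<in> {v. Q v = 0}" using assms(2)[of 0 0] by simp
  fix v w assume "v \<in> {v. Q v = 0}" "w \<in> {v. Q v = 0}"
  then show "v + w \<in> {v. Q v = 0}"
    using assms(1)[of "v + w"] assms(1)[of "v - w"] assms(3)[of v w] by simp
qed (simp add: assms(2))

text \<open>Schur's lemma for quadratic forms. The form is given by homogeneity and the
  parallelogram law, so that the eigenspace of the largest eigenvalue appears as a null set, without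
  passing to a symmetric matrix.\<close>

lemma irreducible_quadratic_form:
  fixes G :: "(real^'n^'n) set" and Q :: "real^'n \<Rightarrow> real"
  assumes G: "subgroup G orthogonal_group" "acts_irreducibly G"
    and Q: "continuous_on UNIV Q" "\<And>c v. Q (c *\<^sub>R v) = c\<^sup>2 * Q v"
      "\<And>v w. Q (v + w) + Q (v - w) = 2 * Q v + 2 * Q w"
    and inv: "\<And>U v. U \<in> G \<Longrightarrow> Q (U *v v) = Q v"
  obtains l where "\<And>v. Q v = l * (norm v)\<^sup>2"
proof -
  obtain z :: "real^'n" where "norm z = 1"
    using vector_choose_size[of 1] by auto
  then have "sphere 0 1 \<noteq> ({} :: (real^'n) set)" by auto
  then obtain u :: "real^'n" where u: "norm u = 1" and max: "\<And>v. norm v = 1 \<Longrightarrow> Q v \<le> Q u"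
    using continuous_attains_sup[OF compact_sphere, of 0 1 Q]
      continuous_on_subset[OF Q(1) subset_UNIV] by auto
  define R where "R v = Q u * (norm v)\<^sup>2 - Q v" for v
  define E where "E = {v. R v = 0}"
  have R: "R (c *\<^sub>R v) = c\<^sup>2 * R v" for c v
    by (simp add: R_def Q(2) power_mult_distrib algebra_simps)
  have "0 \<le> R v" for v
  proof (cases "v = 0")
    case True
    then show ?thesis using R[of 0 0] by simp
  next
    case False
    \<comment> \<open>On unit vectors this is the maximality of \<open>Q u\<close>; homogeneity
      carries it to all \<open>v\<close>.\<close>
    have "0 \<le> R (v /\<^sub>R norm v)"
      using False max[of "v /\<^sub>R norm v"] by (simp add: R_def)
    then have "0 \<le> (norm v)\<^sup>2 * R (v /\<^sub>R norm v)" by simp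
    also have "\<dots> = R v" using False R[of "norm v" "v /\<^sub>R norm v"] by simp
    finally show ?thesis .
  qed
  moreover have "R (v + w) + R (v - w) = 2 * R v + 2 * R w" for v w
  proof -
    have "(norm (v + w))\<^sup>2 + (norm (v - w))\<^sup>2 = 2 * (norm v)\<^sup>2 + 2 * (norm w)\<^sup>2"
      by (simp add: power2_norm_eq_inner inner_simps inner_commute)
    then have "Q u * (norm (v + w))\<^sup>2 + Q u * (norm (v - w))\<^sup>2
        = Q u * (2 * (norm v)\<^sup>2 + 2 * (norm w)\<^sup>2)"
      by (metis distrib_left)
    then show ?thesis using Q(3)[of v w] by (simp add: R_def algebra_simps)
  qed
  ultimately have "subspace E"
    unfolding E_def using R by (intro subspace_null_set)
  moreover have "u \<in> E" by (simp add: E_def R_def u)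
  then have "{0} \<noteq> E" using u by auto
  moreover have "{U *v x | U x. U \<in> G \<and> x \<in> E} = E"
  proof
    show "{U *v x | U x. U \<in> G \<and> x \<in> E} \<subseteq> E"
      by (auto simp: E_def R_def inv
          orthogonal_transformation_norm[OF orthogonal_group_transformation[OF G(1)]])
    \<comment> \<open>Invariance is an equality of sets in \<open>acts_irreducibly\<close>; the
      identity matrix supplies the reverse inclusion.\<close>
    have "mat 1 \<in> G"
      using subgroup.one_closed[OF G(1)] by (simp add: orthogonal_group_def)
    then show "E \<subseteq> {U *v x | U x. U \<in> G \<and> x \<in> E}"
      using matrix_vector_mul_lid by (metis (mono_tags, lifting) mem_Collect_eq subsetI)
  qed
  ultimately have "E = UNIV"
    using G(2) unfolding acts_irreducibly_def by blast
  then have "Q v = Q u * (norm v)\<^sup>2" for v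
    unfolding E_def R_def using UNIV_I[of v] by (simp add: set_eq_iff)
  then show ?thesis using that by blast
qed

section \<open>The sum of squares over the minimal vectors\<close>

theorem theorem1p2:
  fixes G :: "(real^'k^'k) set" and f :: "real^'k"
  assumes "irreducible_group_frame G f"
    and "rational_frame (group_orbit G f)"
  shows "strongly_eutactic (int_span (group_orbit G f))"
proof -
  define F where "F = group_orbit G f"
  define L where "L = int_span F"
  define M where "M = min_vectors L"
  define Q where "Q v = (\<Sum>x\<in>M. (v \<bullet> x)\<^sup>2)" for v
  have G: "subgroup G orthogonal_group" "acts_irreducibly G"
    and F: "rational_frame F" "span F = UNIV"
    using assms
    by (auto simp: irreducible_group_frame_def group_frame_def F_def)
  note orth = orthogonal_group_transformation[OF G(1)]
  have fin: "finite (L \<inter> cball 0 r)" for r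
    unfolding L_def by (intro uniform_discrete_finite_cball uniform_discrete_int_span F(1))
  have "finite M"
    by (rule finite_subset[OF _ fin[of "min_norm L"]]) (auto simp: M_def min_vectors_def)
  \<comment> \<open>A nonzero lattice vector is needed for minimal vectors to exist. The space has
    positive dimension because the index type is nonempty.\<close>
  have "\<not> F \<subseteq> {0}"
  proof
    assume "F \<subseteq> {0}"
    then have "UNIV \<subseteq> {0 :: real^'k}"
      using span_mono[of F "{0}"] F(2) by simp
    moreover obtain w :: "real^'k" where "norm w = 1"
      using vector_choose_size[of 1] by auto
    ultimately show False by auto
  qed
  then obtain y where "y \<in> L" "y \<noteq> 0"
    unfolding L_def using int_span_base by blast
  then obtain z where z: "z \<in> M" "z \<noteq> 0"
    using min_norm_attained[OF fin] unfolding M_def min_vectors_def by blast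
  have maps: "U *v x \<in> M" if "U \<in> G" "x \<in> M" for U x
  proof -
    \<comment> \<open>Left multiplication by \<open>U\<close> maps \<open>G\<close> into itself, so
      \<open>U\<close> preserves the orbit and hence its integer span.\<close>
    have "(*v) U ` F \<subseteq> F"
      using subgroup.m_closed[OF G(1) that(1)]
      by (auto simp: F_def group_orbit_def matrix_vector_mul_assoc orthogonal_group_def)
    then have "U *v x \<in> L"
      using that(2) int_span_linear_image[of x F "(*v) U" F]
      unfolding L_def M_def min_vectors_def
      by (auto simp: image_subset_iff int_span_base)
    moreover have "norm (U *v x) = norm x"
      by (rule orthogonal_transformation_norm[OF orth[OF that(1)]])
    ultimately show ?thesis
      using that(2) by (simp add: M_def min_vectors_def)
  qed
  have inv: "Q (U *v v) = Q v" if U: "U \<in> G" for U v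
  proof -
    have inj: "inj_on ((*v) U) M"
      using orthogonal_transformation_inj[OF orth[OF U]] by (rule inj_on_subset) simp
    \<comment> \<open>An injective self-map of a finite set is onto. Reindexing the sum by
      \<open>U\<close> then cancels \<open>U\<close> from both sides of each inner product.\<close>
    have "(*v) U ` M = M"
      using maps[OF U] \<open>finite M\<close> inj by (intro endo_inj_surj) auto
    then have "Q (U *v v) = (\<Sum>x\<in>((*v) U ` M). ((U *v v) \<bullet> x)\<^sup>2)"
      by (simp add: Q_def)
    also have "\<dots> = Q v"
      using orth[OF U] by (simp add: Q_def sum.reindex[OF inj] orthogonal_transformation_def)
    finally show ?thesis .
  qed
  obtain l where l: "\<And>v. Q v = l * (norm v)\<^sup>2"
  proof (rule irreducible_quadratic_form[OF G, of Q])
    show "continuous_on UNIV Q"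
      unfolding Q_def by (intro continuous_intros)
    show "Q (c *\<^sub>R v) = c\<^sup>2 * Q v" for c v
      by (simp add: Q_def power_mult_distrib sum_distrib_left)
    show "Q (v + w) + Q (v - w) = 2 * Q v + 2 * Q w" for v w
      by (simp add: Q_def sum_distrib_left flip: sum.distrib)
        (simp add: inner_simps power2_eq_square algebra_simps)
  qed (use inv that in auto)
  \<comment> \<open>The term of the sum at \<open>z\<close> itself is the fourth power of
    \<open>norm z\<close>. This fixes the sign of \<open>l\<close>, and the eutaxy constant is then
    \<open>1 / l\<close>.\<close>
  have "0 < Q z"
    unfolding Q_def using z \<open>finite M\<close> by (intro sum_pos2[of _ z]) auto
  then have "l > 0"
    by (simp add: l zero_less_mult_iff)
  then have "(norm v)\<^sup>2 = (1 / l) * (\<Sum>x\<in>M. (v \<bullet> x)\<^sup>2)" for v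
    using l[of v] by (simp add: Q_def)
  then show ?thesis
    unfolding strongly_eutactic_def
    using euclidean_lattice_int_span[OF F(1)] \<open>l > 0\<close>
    by (fold F_def, fold L_def, fold M_def) (auto intro!: exI[of _ "1 / l"])
qed

end
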